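(* For $\theta=(\theta_0,\theta_1,\theta_2)\in\Theta_{\mathbb{L}^2}$, the Fisher information matrix of the family of 2D hyperboloid distributions in the coordinates $(\theta_0,\theta_1,\theta_2)$ is $$I(\theta)=\frac{1}{|\theta|^4}\begin{bmatrix}(2+|\theta|)\theta_0^2-|\theta|^2(1+|\theta|)&-(2+|\theta|)\theta_0\theta_1&-(2+|\theta|)\theta_0\theta_2\\-(2+|\theta|)\theta_0\theta_1&(2+|\theta|)\theta_1^2+|\theta|^2(1+|\theta|)&(2+|\theta|)\theta_1\theta_2\\-(2+|\theta|)\theta_0\theta_2&(2+|\theta|)\theta_1\theta_2&(2+|\theta|)\theta_2^2+|\theta|^2(1+|\theta|)\end{bmatrix}.$$
   Context: $\Theta_{\mathbb{L}^2}=\{\theta\in\mathbb{R}^3:\theta_0>\sqrt{\theta_1^2+\theta_2^2}\}$ and $|\theta|=\sqrt{\theta_0^2-\theta_1^2-\theta_2^2}$. The 2D hyperboloid distribution with parameter $\theta\in\Theta_{\mathbb{L}^2}$ is the probability distribution on $\mathbb{R}^2$ with Lebesgue density $$p_\theta(x_1,x_2)=\frac{|\theta|e^{|\theta|}}{2\pi}\,\frac{\exp\left(-(\theta_0\sqrt{1+x_1^2+x_2^2}-\theta_1x_1-\theta_2x_2)\right)}{\sqrt{1+x_1^2+x_2^2}}.$$ The Fisher information matrix is $I(\theta)=-E_{p_\theta}\left[\nabla_\theta^2\log p_\theta\right]$. *)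

theory Defs
  imports "HOL-Analysis.Analysis"
begin

text \<open>
  A parameter \<open>\<theta> = (\<theta>\<^sub>0, \<theta>\<^sub>1, \<theta>\<^sub>2)\<close> is the vector \<open>vector [\<theta>\<^sub>0, \<theta>\<^sub>1, \<theta>\<^sub>2] :: real^3\<close>. The library numbers
  components from 1, so \<open>\<theta>\<^sub>0, \<theta>\<^sub>1, \<theta>\<^sub>2\<close> are \<open>\<theta> $ 1\<close>, \<open>\<theta> $ 2\<close>, \<open>\<theta> $ 3\<close>.
\<close>

definition hyperboloid_params :: "(real^3) set" where
  "hyperboloid_params = {\<theta>. \<theta> $ 1 > sqrt ((\<theta> $ 2)^2 + (\<theta> $ 3)^2)}"

definition minkowski_norm :: "real^3 \<Rightarrow> real" where
  "minkowski_norm \<theta> = sqrt ((\<theta> $ 1)^2 - (\<theta> $ 2)^2 - (\<theta> $ 3)^2)"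

definition hyperboloid_density :: "real^3 \<Rightarrow> real^2 \<Rightarrow> real" where
  "hyperboloid_density \<theta> x =
     minkowski_norm \<theta> * exp (minkowski_norm \<theta>) / (2 * pi) *
     (exp (- (\<theta> $ 1 * sqrt (1 + (x $ 1)^2 + (x $ 2)^2) - \<theta> $ 2 * x $ 1 - \<theta> $ 3 * x $ 2))
      / sqrt (1 + (x $ 1)^2 + (x $ 2)^2))"

definition partial_deriv :: "'n::finite \<Rightarrow> (real^'n \<Rightarrow> real) \<Rightarrow> real^'n \<Rightarrow> real" where
  "partial_deriv i f \<theta> = deriv (\<lambda>t. f (\<theta> + t *\<^sub>R axis i 1)) 0"

definition hessian :: "(real^'n \<Rightarrow> real) \<Rightarrow> real^'n \<Rightarrow> real^'n^'n" where
  "hessian f \<theta> = (\<chi> i j. partial_deriv i (partial_deriv j f) \<theta>)"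

text \<open>
  The expectation is the Bochner integral of the matrix-valued function; it is 0 if that
  function is not integrable.
\<close>

definition fisher_information ::
    "(real^'n \<Rightarrow> 'a::euclidean_space \<Rightarrow> real) \<Rightarrow> real^'n \<Rightarrow> real^'n^'n" where
  "fisher_information p \<theta> =
     - (\<integral>x. hessian (\<lambda>\<eta>. ln (p \<eta> x)) \<theta> \<partial>density lborel (\<lambda>x. ennreal (p \<theta> x)))"

end

theory Submission
  imports Defs "HOL-Real_Asymp.Real_Asymp"
begin

text \<open>
  Since \<open>ln p\<^sub>\<theta>\<close> is \<open>ln |\<theta>| + |\<theta>|\<close> plus a function affine in \<open>\<theta>\<close>, its Hessian does not depend on \<open>x\<close>, and the
  expectation is this constant matrix times the total mass of \<open>p\<^sub>\<theta>\<close>. The total mass is 1: the measure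
  \<open>dx\<^sub>1 dx\<^sub>2 / sqrt (1 + x\<^sub>1\<^sup>2 + x\<^sub>2\<^sup>2)\<close> is invariant under Lorentz boosts, so boosting in \<open>x\<^sub>2\<close> with \<open>x\<^sub>1\<close> fixed and
  then in \<open>x\<^sub>1\<close> with \<open>x\<^sub>2\<close> fixed replaces \<open>\<theta>\<close> by \<open>(|\<theta>|, 0, 0)\<close>; the remaining radial integral follows from
  Tonelli's theorem (layer cake) and the area of a disc.
\<close>

section \<open>Substitution on the line and Lorentz boosts\<close>

text \<open>The substitution rule for absolutely integrable functions carries over to values in
  [0, infinity]: for nonnegative integrands it shows that both sides take the same finite values, so
  neither side has to be known finite beforehand.\<close>

lemma nn_integral_change_of_variables:
  fixes f g g' :: "real \<Rightarrow> real"
  assumes [measurable]: "f \<in> borel_measurable borel" "g \<in> borel_measurable borel"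
      "g' \<in> borel_measurable borel"
    and f_nonneg: "\<And>x. 0 \<le> f x" and g'_nonneg: "\<And>x. 0 \<le> g' x"
    and deriv: "\<And>x. (g has_field_derivative g' x) (at x)"
    and "bij g"
  shows "(\<integral>\<^sup>+x. ennreal (f x) \<partial>lborel) = (\<integral>\<^sup>+x. ennreal (g' x * f (g x)) \<partial>lborel)"
proof -
  \<comment> \<open>This translates between the Lebesgue integral and the gauge integral, in which
    the substitution rule is phrased.\<close>
  have nn_iff: "(\<integral>\<^sup>+x. ennreal (h x) \<partial>lborel) = ennreal I \<longleftrightarrow>
      h absolutely_integrable_on UNIV \<and> integral UNIV h = I"
    if [measurable]: "h \<in> borel_measurable borel" and h: "\<And>x. 0 \<le> h x" and I: "0 \<le> I"
    for h :: "real \<Rightarrow> real" and I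
  proof -
    have "(\<integral>\<^sup>+x. ennreal (h x) \<partial>lborel) = ennreal I \<longleftrightarrow> (h has_integral I) UNIV"
      using nn_integral_has_integral[of h I] nn_integral_has_integral_lborel[of h I] that by blast
    also have "\<dots> \<longleftrightarrow> h integrable_on UNIV \<and> integral UNIV h = I"
      using integrable_integral by blast
    also have "h integrable_on UNIV \<longleftrightarrow> h absolutely_integrable_on UNIV"
      using h by (simp add: absolutely_integrable_on_iff_nonneg)
    finally show ?thesis .
  qed
  have "(\<integral>\<^sup>+x. ennreal (f x) \<partial>lborel) = ennreal I \<longleftrightarrow>
      (\<integral>\<^sup>+x. ennreal (g' x * f (g x)) \<partial>lborel) = ennreal I" if "0 \<le> I" for I
  proof -
    have "inj_on g UNIV" "range g = UNIV"
      using \<open>bij g\<close> by (auto simp: bij_def)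
    then show ?thesis
      using has_absolute_integral_change_of_variables_1'[of UNIV g g' f I] deriv f_nonneg g'_nonneg that
      by (simp add: nn_iff)
  qed
  \<comment> \<open>If one side is finite, the other has the same value; otherwise both are
    infinite.\<close>
  then show ?thesis
    by (metis ennreal_cases)
qed

text \<open>
  For fixed \<open>c > 0\<close> the Lorentz boost with direction \<open>(a, b)\<close> sends the point \<open>(s, x)\<close> of the hyperbola
  \<open>s\<^sup>2 = c + x\<^sup>2\<close> to \<open>((a s + b x) / \<rho>, (a x + b s) / \<rho>)\<close>.
\<close>

lemma boost_sqrt:
  fixes a b c x :: real
  assumes "0 < c" "\<bar>b\<bar> < a"
  defines "\<rho> \<equiv> sqrt (a\<^sup>2 - b\<^sup>2)"
  shows "sqrt (c + ((a * x + b * sqrt (c + x\<^sup>2)) / \<rho>)\<^sup>2) = (a * sqrt (c + x\<^sup>2) + b * x) / \<rho>"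
proof -
  define s where "s = sqrt (c + x\<^sup>2)"
  have "b\<^sup>2 < a\<^sup>2"
    using assms power_strict_mono[of "\<bar>b\<bar>" a 2] by simp
  then have \<rho>: "0 < \<rho>" "\<rho>\<^sup>2 = a\<^sup>2 - b\<^sup>2"
    by (auto simp: \<rho>_def)
  have s: "s\<^sup>2 = c + x\<^sup>2" "\<bar>x\<bar> \<le> s"
    using assms by (auto simp: s_def intro: real_le_rsqrt add_nonneg_nonneg)
  \<comment> \<open>This fixes the sign of \<open>a * s + b * x\<close>, so that the final square
    root yields this number and not its negative.\<close>
  have "\<bar>b * x\<bar> \<le> a * s"
    unfolding abs_mult using assms s by (intro mult_mono) auto
  then have nonneg: "0 \<le> a * s + b * x"
    by linarith
  have "c + ((a * x + b * s) / \<rho>)\<^sup>2 = (\<rho>\<^sup>2 * c + (a * x + b * s)\<^sup>2) / \<rho>\<^sup>2"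
    using \<rho> by (simp add: field_simps)
  \<comment> \<open>This is the invariance of the form \<open>s^2 - x^2\<close>, whose value is
    \<open>c\<close>, under the boost, cleared of denominators.\<close>
  also have "\<rho>\<^sup>2 * c + (a * x + b * s)\<^sup>2 = (a * s + b * x)\<^sup>2"
  proof -
    have c_eq: "c = s\<^sup>2 - x\<^sup>2" using s by simp
    show ?thesis
      unfolding \<rho>(2) c_eq by (simp add: power2_eq_square algebra_simps)
  qed
  finally have "c + ((a * x + b * s) / \<rho>)\<^sup>2 = ((a * s + b * x) / \<rho>)\<^sup>2"
    by (simp add: power_divide)
  then show ?thesis
    using nonneg \<rho> by (simp add: s_def[symmetric])
qed

text \<open>The boosts with directions \<open>(a, b)\<close> and \<open>(a, - b)\<close> are
  mutually inverse: once \<open>boost_sqrt\<close> has evaluated the root, the mixed terms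
  cancel.\<close>

lemma boost_inverse:
  fixes a b c x :: real
  assumes "0 < c" "\<bar>b\<bar> < a"
  defines "\<rho> \<equiv> sqrt (a\<^sup>2 - b\<^sup>2)"
  defines "y \<equiv> (a * x + b * sqrt (c + x\<^sup>2)) / \<rho>"
  shows "(a * y - b * sqrt (c + y\<^sup>2)) / \<rho> = x"
proof -
  have "b\<^sup>2 < a\<^sup>2"
    using assms power_strict_mono[of "\<bar>b\<bar>" a 2] by simp
  then have \<rho>: "0 < \<rho>" "\<rho>\<^sup>2 = a\<^sup>2 - b\<^sup>2"
    by (auto simp: \<rho>_def)
  have "sqrt (c + y\<^sup>2) = (a * sqrt (c + x\<^sup>2) + b * x) / \<rho>"
    unfolding y_def \<rho>_def by (rule boost_sqrt) fact+
  then have "(a * y - b * sqrt (c + y\<^sup>2)) / \<rho> = (a\<^sup>2 - b\<^sup>2) * x / \<rho>\<^sup>2"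
    by (simp only:) (simp add: y_def power2_eq_square diff_divide_distrib[symmetric] algebra_simps)
  also have "\<dots> = x"
    unfolding \<rho>(2)[symmetric] using \<rho>(1) by simp
  finally show ?thesis .
qed

text \<open>The boost \<open>g\<close> preserves the measure \<open>dx / sqrt (c + x^2)\<close> and
  pulls the form \<open>a * s - b * x\<close> back to \<open>\<rho> * s\<close>, where
  \<open>s = sqrt (c + x^2)\<close>. The constant \<open>d\<close> makes room for terms in a
  variable held fixed.\<close>

lemma nn_integral_boost:
  fixes a b c d :: real
  assumes c: "0 < c" and ab: "\<bar>b\<bar> < a"
  shows "(\<integral>\<^sup>+x. ennreal (exp (- (a * sqrt (c + x\<^sup>2) - b * x - d)) / sqrt (c + x\<^sup>2)) \<partial>lborel) =
    (\<integral>\<^sup>+x. ennreal (exp (- (sqrt (a\<^sup>2 - b\<^sup>2) * sqrt (c + x\<^sup>2) - d)) / sqrt (c + x\<^sup>2)) \<partial>lborel)"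
proof -
  define \<rho> where "\<rho> = sqrt (a\<^sup>2 - b\<^sup>2)"
  define g where "g x = (a * x + b * sqrt (c + x\<^sup>2)) / \<rho>" for x
  define g' where "g' x = (a * sqrt (c + x\<^sup>2) + b * x) / \<rho> / sqrt (c + x\<^sup>2)" for x
  define f where "f x = exp (- (a * sqrt (c + x\<^sup>2) - b * x - d)) / sqrt (c + x\<^sup>2)" for x
  have "b\<^sup>2 < a\<^sup>2"
    using assms power_strict_mono[of "\<bar>b\<bar>" a 2] by simp
  then have \<rho>: "0 < \<rho>" "\<rho>\<^sup>2 = a\<^sup>2 - b\<^sup>2"
    by (auto simp: \<rho>_def)
  have pos: "0 < c + x\<^sup>2" for x
    using c by (simp add: add_pos_nonneg)
  have sqrt_g: "sqrt (c + (g x)\<^sup>2) = (a * sqrt (c + x\<^sup>2) + b * x) / \<rho>" for x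
    unfolding g_def \<rho>_def by (rule boost_sqrt[OF c ab])
  \<comment> \<open>The invariance of the measure in differential form; the numerator will cancel
    the denominator of \<open>f (g x)\<close>.\<close>
  have g'_eq: "g' x = sqrt (c + (g x)\<^sup>2) / sqrt (c + x\<^sup>2)" for x
    by (simp add: sqrt_g g'_def)
  have "bij g"
  proof (rule o_bij)
    show "(\<lambda>y. (a * y - b * sqrt (c + y\<^sup>2)) / \<rho>) \<circ> g = id"
      using boost_inverse[OF c ab] by (auto simp: g_def \<rho>_def)
    show "g \<circ> (\<lambda>y. (a * y - b * sqrt (c + y\<^sup>2)) / \<rho>) = id"
      using boost_inverse[OF c, of "-b" a] ab by (auto simp: g_def \<rho>_def)
  qed
  moreover have "(g has_field_derivative g' x) (at x)" for x
    unfolding g_def[abs_def] g'_def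
    using pos[of x] \<rho> by (auto intro!: derivative_eq_intros simp: field_simps)
  moreover have "0 \<le> g' x" for x
    unfolding g'_eq using pos[of x] pos[of "g x"] by simp
  moreover have [measurable]: "f \<in> borel_measurable borel" "g \<in> borel_measurable borel"
      "g' \<in> borel_measurable borel"
    by (simp_all add: f_def[abs_def] g_def[abs_def] g'_def[abs_def])
  moreover have "0 \<le> f x" for x
    using pos[of x] by (simp add: f_def)
  ultimately have "(\<integral>\<^sup>+x. ennreal (f x) \<partial>lborel) = (\<integral>\<^sup>+x. ennreal (g' x * f (g x)) \<partial>lborel)"
    by (intro nn_integral_change_of_variables) auto
  moreover have "g' x * f (g x) = exp (- (\<rho> * sqrt (c + x\<^sup>2) - d)) / sqrt (c + x\<^sup>2)" for x
  proof -
    \<comment> \<open>The two terms \<open>a * b * x / \<rho>\<close> cancel.\<close>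
    have "a * sqrt (c + (g x)\<^sup>2) - b * g x = (a\<^sup>2 - b\<^sup>2) * sqrt (c + x\<^sup>2) / \<rho>"
      unfolding sqrt_g unfolding g_def using \<rho>(1) by (simp add: field_simps power2_eq_square)
    also have "\<dots> = \<rho> * sqrt (c + x\<^sup>2)"
      unfolding \<rho>(2)[symmetric] using \<rho>(1) by (simp add: power2_eq_square)
    finally have "f (g x) = exp (- (\<rho> * sqrt (c + x\<^sup>2) - d)) / sqrt (c + (g x)\<^sup>2)"
      by (simp add: f_def)
    then show ?thesis
      unfolding g'_eq using pos[of "g x"] by simp
  qed
  ultimately show ?thesis
    by (simp add: f_def \<rho>_def)
qed

section \<open>The radial integral\<close>

lemma nn_integral_hyperboloid_radial:
  fixes r :: real
  assumes r: "0 < r"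
  shows "(\<integral>\<^sup>+x. \<integral>\<^sup>+y. ennreal (exp (- (r * sqrt (1 + x\<^sup>2 + y\<^sup>2))) / sqrt (1 + x\<^sup>2 + y\<^sup>2))
      \<partial>lborel \<partial>lborel) = ennreal (2 * pi * exp (- r) / r)"
proof -
  define u :: "real \<times> real \<Rightarrow> real" where "u z = sqrt (1 + (norm z)\<^sup>2)" for z
  \<comment> \<open>\<open>k\<close> is minus the derivative of \<open>exp (- (r * v)) / v\<close>,
    the integrand as a function of the level \<open>v\<close> of \<open>u\<close>.\<close>
  define k where "k v = (r / v + 1 / v\<^sup>2) * exp (- (r * v))" for v
  \<comment> \<open>Integration by parts gives this antiderivative of disc area times
    \<open>k\<close>; it vanishes at infinity.\<close>
  define F where "F v = - (pi * (v\<^sup>2 - 1) * exp (- (r * v)) / v) - 2 * pi * exp (- (r * v)) / r" for v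
  have [measurable]: "u \<in> borel_measurable borel" "k \<in> borel_measurable borel"
    by (simp_all add: u_def[abs_def] k_def[abs_def])
  have u1: "1 \<le> u z" for z
    by (simp add: u_def)
  have k_nonneg: "0 \<le> k v" if "0 < v" for v
    using that r by (simp add: k_def)
  have tail: "ennreal (exp (- (r * w)) / w) = (\<integral>\<^sup>+v. ennreal (k v) * indicator {w..} v \<partial>lborel)"
    if w: "0 < w" for w
  proof -
    have "(\<integral>\<^sup>+v. ennreal (k v) * indicator {w..} v \<partial>lborel) = ennreal (0 - (- exp (- (r * w)) / w))"
    proof (rule nn_integral_FTC_atLeast)
      show "((\<lambda>v. - exp (- (r * v)) / v) has_field_derivative k x) (at x)" if "w \<le> x" for x
        using that w unfolding k_def
        by (auto intro!: derivative_eq_intros simp: field_simps power2_eq_square)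
      show "((\<lambda>v. - exp (- (r * v)) / v) \<longlongrightarrow> 0) at_top"
        using r by real_asymp
    qed (use w k_nonneg in auto)
    then show ?thesis by simp
  qed
  have disc: "emeasure lborel {z. u z \<le> v} = ennreal (pi * (v\<^sup>2 - 1))" if "1 \<le> v" for v
  proof -
    have "u z \<le> v \<longleftrightarrow> norm z \<le> sqrt (v\<^sup>2 - 1)" for z
    proof -
      have "u z \<le> v \<longleftrightarrow> 1 + (norm z)\<^sup>2 \<le> v\<^sup>2"
        unfolding u_def using that by (auto intro: real_le_lsqrt dest: sqrt_le_D)
      also have "\<dots> \<longleftrightarrow> (norm z)\<^sup>2 \<le> (sqrt (v\<^sup>2 - 1))\<^sup>2"
        using that by auto
      also have "\<dots> \<longleftrightarrow> norm z \<le> sqrt (v\<^sup>2 - 1)"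
        using that by (subst power_mono_iff) auto
      finally show ?thesis .
    qed
    then have "{z. u z \<le> v} = cball 0 (sqrt (v\<^sup>2 - 1))"
      by auto
    then show ?thesis
      using that by (simp add: emeasure_cball unit_ball_vol_2)
  qed
  have "(\<integral>\<^sup>+x. \<integral>\<^sup>+y. ennreal (exp (- (r * sqrt (1 + x\<^sup>2 + y\<^sup>2))) / sqrt (1 + x\<^sup>2 + y\<^sup>2)) \<partial>lborel \<partial>lborel)
      = (\<integral>\<^sup>+x. \<integral>\<^sup>+y. ennreal (exp (- (r * u (x, y))) / u (x, y)) \<partial>lborel \<partial>lborel)"
    by (simp add: u_def norm_Pair add.assoc)
  also have "\<dots> = (\<integral>\<^sup>+z. ennreal (exp (- (r * u z)) / u z) \<partial>(lborel \<Otimes>\<^sub>M lborel))"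
    by (rule lborel.nn_integral_fst) (simp add: lborel_prod)
  also have "\<dots> = (\<integral>\<^sup>+z. \<integral>\<^sup>+v. ennreal (k v) * indicator {u z..} v \<partial>lborel \<partial>(lborel :: (real \<times> real) measure))"
    unfolding lborel_prod using u1 by (intro nn_integral_cong tail) (meson less_le_trans zero_less_one)
  also have "\<dots> = (\<integral>\<^sup>+v. \<integral>\<^sup>+z. ennreal (k v) * indicator {u z..} v \<partial>(lborel :: (real \<times> real) measure) \<partial>lborel)"
  proof (rule lborel_pair.Fubini'[symmetric])
    \<comment> \<open>The indicator of a moving half-line becomes that of one fixed set of pairs,
      whose measurability follows from that of \<open>u\<close>.\<close>
    have "(\<lambda>(z, v). ennreal (k v) * indicator {u z..} v) =
        (\<lambda>p. ennreal (k (snd p)) * indicator {p. u (fst p) \<le> snd p} p)"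
      by (auto simp: fun_eq_iff indicator_def)
    also have "\<dots> \<in> borel_measurable (lborel \<Otimes>\<^sub>M lborel)"
      by measurable
    finally show "(\<lambda>(z, v). ennreal (k v) * indicator {u z..} v) \<in>
        borel_measurable (lborel \<Otimes>\<^sub>M lborel)" .
  qed
  also have "\<dots> = (\<integral>\<^sup>+v. ennreal (pi * (v\<^sup>2 - 1) * k v) * indicator {1..} v \<partial>lborel)"
  proof (rule nn_integral_cong)
    fix v :: real
    have "(\<integral>\<^sup>+z. ennreal (k v) * indicator {u z..} v \<partial>lborel) =
        (\<integral>\<^sup>+z. ennreal (k v) * indicator {z. u z \<le> v} z \<partial>lborel)"
      by (intro nn_integral_cong) (auto simp: indicator_def)
    also have "\<dots> = ennreal (k v) * emeasure lborel {z. u z \<le> v}"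
      by (rule nn_integral_cmult_indicator) measurable
    also have "\<dots> = ennreal (pi * (v\<^sup>2 - 1) * k v) * indicator {1..} v"
    proof (cases "1 \<le> v")
      case True
      then show ?thesis
        using k_nonneg[of v] by (simp add: disc ennreal_mult'[symmetric] mult.commute)
    next
      \<comment> \<open>Levels below 1 contribute nothing because \<open>u\<close> is at least 1;
        hence the lower limit 1 of the outer integral.\<close>
      case False
      then have empty: "{z. u z \<le> v} = {}"
        using u1 by (auto dest: order_trans)
      show ?thesis
        unfolding empty using False by simp
    qed
    finally show "(\<integral>\<^sup>+z. ennreal (k v) * indicator {u z..} v \<partial>lborel) =
        ennreal (pi * (v\<^sup>2 - 1) * k v) * indicator {1..} v" .
  qed
  also have "\<dots> = ennreal (0 - F 1)"
  proof (rule nn_integral_FTC_atLeast)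
    show "(F has_field_derivative pi * (x\<^sup>2 - 1) * k x) (at x)" if "1 \<le> x" for x
    proof -
      have "x \<noteq> 0" using that by auto
      then show ?thesis
        unfolding k_def F_def[abs_def] using r
        by (auto intro!: derivative_eq_intros simp: field_simps power2_eq_square)
    qed
    show "(F \<longlongrightarrow> 0) at_top"
      unfolding F_def[abs_def] using r by real_asymp
    show "0 \<le> pi * (x\<^sup>2 - 1) * k x" if "1 \<le> x" for x
      using that k_nonneg[of x] by (simp add: one_le_power)
  qed measurable
  also have "\<dots> = ennreal (2 * pi * exp (- r) / r)"
    by (simp add: F_def)
  finally show ?thesis .
qed

section \<open>Reduction to the radial case by two boosts\<close>

lemma nn_integral_hyperboloid:
  fixes a b c :: real
  assumes "b\<^sup>2 + c\<^sup>2 < a\<^sup>2" "0 < a"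
  defines "r \<equiv> sqrt (a\<^sup>2 - b\<^sup>2 - c\<^sup>2)"
  shows "(\<integral>\<^sup>+x. \<integral>\<^sup>+y. ennreal (exp (- (a * sqrt (1 + x\<^sup>2 + y\<^sup>2) - b * x - c * y)) / sqrt (1 + x\<^sup>2 + y\<^sup>2))
      \<partial>lborel \<partial>lborel) = ennreal (2 * pi * exp (- r) / r)"
proof -
  \<comment> \<open>The coefficient of the root after the boost in \<open>y\<close>. Since
    \<open>\<bar>b\<bar> < a'\<close>, the second boost is still admissible, and it turns
    \<open>a'\<close> into \<open>r\<close>.\<close>
  define a' where "a' = sqrt (a\<^sup>2 - c\<^sup>2)"
  have "c\<^sup>2 < a\<^sup>2" "b\<^sup>2 < a\<^sup>2 - c\<^sup>2"
    using assms zero_le_power2[of b] by linarith+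
  then have c: "\<bar>c\<bar> < a" and b: "\<bar>b\<bar> < a'" and a': "a'\<^sup>2 = a\<^sup>2 - c\<^sup>2"
    using assms(2) real_less_rsqrt[of "\<bar>b\<bar>"] by (auto simp: a'_def intro: power2_less_imp_less)
  have pos: "0 < 1 + t\<^sup>2" for t :: real
    by (simp add: add_pos_nonneg)
  have "(\<integral>\<^sup>+x. \<integral>\<^sup>+y. ennreal (exp (- (a * sqrt (1 + x\<^sup>2 + y\<^sup>2) - b * x - c * y)) / sqrt (1 + x\<^sup>2 + y\<^sup>2)) \<partial>lborel \<partial>lborel)
    = (\<integral>\<^sup>+x. \<integral>\<^sup>+y. ennreal (exp (- (a' * sqrt (1 + x\<^sup>2 + y\<^sup>2) - b * x)) / sqrt (1 + x\<^sup>2 + y\<^sup>2)) \<partial>lborel \<partial>lborel)"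
  proof (rule nn_integral_cong)
    fix x :: real
    show "(\<integral>\<^sup>+y. ennreal (exp (- (a * sqrt (1 + x\<^sup>2 + y\<^sup>2) - b * x - c * y)) / sqrt (1 + x\<^sup>2 + y\<^sup>2)) \<partial>lborel)
      = (\<integral>\<^sup>+y. ennreal (exp (- (a' * sqrt (1 + x\<^sup>2 + y\<^sup>2) - b * x)) / sqrt (1 + x\<^sup>2 + y\<^sup>2)) \<partial>lborel)"
      unfolding a'_def using nn_integral_boost[OF pos c, of x "b * x"]
      by (simp only: cancel_ab_semigroup_add_class.diff_right_commute[of _ "b * x"])
  qed
  \<comment> \<open>The second boost acts in \<open>x\<close> with \<open>y\<close> fixed, so
    \<open>x\<close> has to be the inner variable.\<close>
  also have "\<dots> = (\<integral>\<^sup>+y. \<integral>\<^sup>+x. ennreal (exp (- (a' * sqrt (1 + x\<^sup>2 + y\<^sup>2) - b * x)) / sqrt (1 + x\<^sup>2 + y\<^sup>2)) \<partial>lborel \<partial>lborel)"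
    by (rule lborel_pair.Fubini'[symmetric]) measurable
  also have "\<dots> = (\<integral>\<^sup>+y. \<integral>\<^sup>+x. ennreal (exp (- (r * sqrt (1 + y\<^sup>2 + x\<^sup>2))) / sqrt (1 + y\<^sup>2 + x\<^sup>2)) \<partial>lborel \<partial>lborel)"
  proof (rule nn_integral_cong)
    fix y :: real
    show "(\<integral>\<^sup>+x. ennreal (exp (- (a' * sqrt (1 + x\<^sup>2 + y\<^sup>2) - b * x)) / sqrt (1 + x\<^sup>2 + y\<^sup>2)) \<partial>lborel)
      = (\<integral>\<^sup>+x. ennreal (exp (- (r * sqrt (1 + y\<^sup>2 + x\<^sup>2))) / sqrt (1 + y\<^sup>2 + x\<^sup>2)) \<partial>lborel)"
      using nn_integral_boost[OF pos b, of y 0]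
      by (simp only: a' r_def diff_0_right cancel_ab_semigroup_add_class.diff_right_commute[of _ "c\<^sup>2"] add.assoc add.commute[of "y\<^sup>2"])
  qed
  also have "\<dots> = ennreal (2 * pi * exp (- r) / r)"
    by (rule nn_integral_hyperboloid_radial) (use assms in \<open>simp add: r_def\<close>)
  finally show ?thesis .
qed

section \<open>Lebesgue measure on \<open>real^2\<close> as a product\<close>

lemma borel_measurable_vector2 [measurable]:
  "(\<lambda>(x, y). vector [x, y] :: real^2) \<in> borel_measurable (lborel \<Otimes>\<^sub>M lborel)"
proof -
  have "continuous_on UNIV (\<lambda>(x, y). vector [x, y] :: real^2)"
    unfolding case_prod_beta
    by (subst continuous_on_componentwise)
      (auto simp: Basis_vec_def inner_axis forall_2 intro!: continuous_intros)
  then show ?thesis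
    unfolding lborel_prod by (simp add: borel_measurable_continuous_onI)
qed

text \<open>Lebesgue measure is determined by its values on boxes, and the preimage of a box is a
  product of two intervals.\<close>

lemma lborel_real2_eq_distr_pair:
  "(lborel :: (real^2) measure) = distr (lborel \<Otimes>\<^sub>M lborel) borel (\<lambda>(x, y). vector [x, y])"
proof (rule lborel_eqI)
  fix l u :: "real^2"
  assume le: "\<And>b. b \<in> Basis \<Longrightarrow> l \<bullet> b \<le> u \<bullet> b"
  have le': "l $ i \<le> u $ i" for i
    using le[of "axis i 1"] by (simp add: inner_axis)
  have "(\<lambda>(x, y). vector [x, y] :: real^2) -` box l u = box (l $ 1) (u $ 1) \<times> box (l $ 2) (u $ 2)"
    by (auto simp: mem_box_cart forall_2)
  then have "emeasure (distr (lborel \<Otimes>\<^sub>M lborel) borel (\<lambda>(x, y). vector [x, y])) (box l u) =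
      emeasure (lborel \<Otimes>\<^sub>M lborel) (box (l $ 1) (u $ 1) \<times> box (l $ 2) (u $ 2))"
    by (simp add: emeasure_distr space_pair_measure)
  also have "\<dots> = ennreal ((u $ 1 - l $ 1) * (u $ 2 - l $ 2))"
    using le' by (subst lborel.emeasure_pair_measure_Times) (auto simp: ennreal_mult)
  also have "(u $ 1 - l $ 1) * (u $ 2 - l $ 2) = (\<Prod>b\<in>Basis. (u - l) \<bullet> b)"
  proof -
    have Basis_eq: "(Basis :: (real^2) set) = {axis 1 1, axis 2 1}"
      by (auto simp: Basis_vec_def UNIV_2)
    have "axis 1 1 \<noteq> (axis 2 1 :: real^2)"
      by (simp add: axis_eq_axis)
    then have "(\<Prod>b\<in>Basis. (u - l) \<bullet> b) = (u - l) \<bullet> axis 1 1 * ((u - l) \<bullet> axis 2 1)"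
      unfolding Basis_eq by simp
    then show ?thesis
      by (simp add: inner_axis)
  qed
  finally show "emeasure (distr (lborel \<Otimes>\<^sub>M lborel) borel (\<lambda>(x, y). vector [x, y])) (box l u) =
      (\<Prod>b\<in>Basis. (u - l) \<bullet> b)" by simp
qed simp

lemma nn_integral_real2_iterated:
  fixes f :: "real^2 \<Rightarrow> ennreal"
  assumes [measurable]: "f \<in> borel_measurable borel"
  shows "(\<integral>\<^sup>+x. f x \<partial>lborel) = (\<integral>\<^sup>+x. \<integral>\<^sup>+y. f (vector [x, y]) \<partial>lborel \<partial>lborel)"
proof -
  have "(\<integral>\<^sup>+x. f x \<partial>lborel) = (\<integral>\<^sup>+z. f (case z of (x, y) \<Rightarrow> vector [x, y]) \<partial>(lborel \<Otimes>\<^sub>M lborel))"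
    by (subst lborel_real2_eq_distr_pair) (simp add: nn_integral_distr)
  also have "\<dots> = (\<integral>\<^sup>+x. \<integral>\<^sup>+y. f (vector [x, y]) \<partial>lborel \<partial>lborel)"
    by (subst lborel.nn_integral_fst[symmetric]) auto
  finally show ?thesis .
qed

section \<open>Total mass of the density\<close>

lemma minkowski_norm_pos:
  assumes "\<theta> \<in> hyperboloid_params"
  shows "0 < \<theta> $ 1" "(\<theta> $ 2)\<^sup>2 + (\<theta> $ 3)\<^sup>2 < (\<theta> $ 1)\<^sup>2" "0 < minkowski_norm \<theta>"
proof -
  have *: "sqrt ((\<theta> $ 2)\<^sup>2 + (\<theta> $ 3)\<^sup>2) < \<theta> $ 1"
    using assms by (simp add: hyperboloid_params_def)
  then show pos: "0 < \<theta> $ 1"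
    by (meson le_less_trans real_sqrt_ge_zero sum_power2_ge_zero)
  show "(\<theta> $ 2)\<^sup>2 + (\<theta> $ 3)\<^sup>2 < (\<theta> $ 1)\<^sup>2"
    using * pos by (metis abs_of_pos real_sqrt_abs real_sqrt_less_iff)
  then show "0 < minkowski_norm \<theta>"
    by (simp add: minkowski_norm_def)
qed

lemma borel_measurable_hyperboloid_density [measurable]:
  "hyperboloid_density \<theta> \<in> borel_measurable borel"
  unfolding hyperboloid_density_def[abs_def]
  by (intro borel_measurable_continuous_onI continuous_intros) (auto simp: add_nonneg_eq_0_iff)

text \<open>The prefactor of the density is the reciprocal of the integral in
  \<open>nn_integral_hyperboloid\<close>.\<close>

lemma nn_integral_hyperboloid_density:
  assumes "\<theta> \<in> hyperboloid_params"
  shows "(\<integral>\<^sup>+x. ennreal (hyperboloid_density \<theta> x) \<partial>lborel) = 1"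
proof -
  define r where "r = minkowski_norm \<theta>"
  define w where "w x y = exp (- (\<theta> $ 1 * sqrt (1 + x\<^sup>2 + y\<^sup>2) - \<theta> $ 2 * x - \<theta> $ 3 * y)) / sqrt (1 + x\<^sup>2 + y\<^sup>2)" for x y
  note pos = minkowski_norm_pos[OF assms]
  have r: "0 < r" "r = sqrt ((\<theta> $ 1)\<^sup>2 - (\<theta> $ 2)\<^sup>2 - (\<theta> $ 3)\<^sup>2)"
    using pos by (simp_all add: r_def minkowski_norm_def)
  have w_nonneg: "0 \<le> w x y" for x y
    by (simp add: w_def)
  have [measurable]: "(\<lambda>(x, y). w x y) \<in> borel_measurable (borel \<Otimes>\<^sub>M borel)"
    unfolding w_def by measurable
  have "(\<integral>\<^sup>+x. ennreal (hyperboloid_density \<theta> x) \<partial>lborel) =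
      (\<integral>\<^sup>+x. \<integral>\<^sup>+y. ennreal (hyperboloid_density \<theta> (vector [x, y])) \<partial>lborel \<partial>lborel)"
    by (rule nn_integral_real2_iterated) measurable
  also have "\<dots> = (\<integral>\<^sup>+x. \<integral>\<^sup>+y. ennreal (r * exp r / (2 * pi)) * ennreal (w x y) \<partial>lborel \<partial>lborel)"
    unfolding hyperboloid_density_def r_def[symmetric] using r(1) w_nonneg
    by (simp add: w_def ennreal_mult'[symmetric])
  also have "\<dots> = ennreal (r * exp r / (2 * pi)) * (\<integral>\<^sup>+x. \<integral>\<^sup>+y. ennreal (w x y) \<partial>lborel \<partial>lborel)"
    by (simp add: nn_integral_cmult)
  also have "(\<integral>\<^sup>+x. \<integral>\<^sup>+y. ennreal (w x y) \<partial>lborel \<partial>lborel) = ennreal (2 * pi * exp (- r) / r)"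
    unfolding w_def r(2) by (rule nn_integral_hyperboloid) (use pos in auto)
  also have "ennreal (r * exp r / (2 * pi)) * ennreal (2 * pi * exp (- r) / r) = 1"
    using r(1) by (simp add: ennreal_mult'[symmetric] exp_minus)
  finally show ?thesis .
qed

section \<open>Derivatives of the log-density\<close>

text \<open>These are the diagonal entries of the Minkowski metric; with them one formula serves all
  three coordinates.\<close>

definition minkowski_sign :: "3 \<Rightarrow> real" where
  "minkowski_sign i = (if i = 1 then 1 else - 1)"

lemma open_hyperboloid_params: "open hyperboloid_params"
  unfolding hyperboloid_params_def by (intro open_Collect_less continuous_intros)

text \<open>The parameter set is open. Formulas valid only on it may therefore be substituted under
  a partial derivative, which depends only on values near \<open>\<theta>\<close>.\<close>

lemma eventually_hyperboloid_params:
  assumes "\<theta> \<in> hyperboloid_params"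
  shows "\<forall>\<^sub>F t in nhds 0. \<theta> + t *\<^sub>R axis i 1 \<in> hyperboloid_params"
proof -
  have "((\<lambda>t. \<theta> + t *\<^sub>R axis i 1) \<longlongrightarrow> \<theta> + 0 *\<^sub>R axis i 1) (nhds 0)"
    by (intro tendsto_intros filterlim_ident)
  then show ?thesis
    using topological_tendstoD[OF _ open_hyperboloid_params] assms by simp
qed

text \<open>The square of the norm is the sum of \<open>minkowski_sign i * (\<theta> $ i)^2\<close>;
  differentiating it and dividing by twice the norm gives the claim.\<close>

lemma has_derivative_minkowski_norm:
  assumes "\<theta> \<in> hyperboloid_params"
  shows "((\<lambda>t. minkowski_norm (\<theta> + t *\<^sub>R axis i 1)) has_field_derivative
    minkowski_sign i * \<theta> $ i / minkowski_norm \<theta>) (at 0)"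
proof -
  have "0 < (\<theta> $ 1)\<^sup>2 - (\<theta> $ 2)\<^sup>2 - (\<theta> $ 3)\<^sup>2"
    using minkowski_norm_pos(2)[OF assms] by simp
  then show ?thesis
    unfolding minkowski_norm_def minkowski_sign_def
    using exhaust_3[of i]
    by (auto intro!: derivative_eq_intros simp: axis_def field_simps)
qed

text \<open>This exhibits an exponential family: \<open>x\<close> and \<open>\<theta>\<close>
  interact only through an inner product, linear in \<open>\<theta>\<close>.\<close>

lemma ln_hyperboloid_density:
  assumes "\<theta> \<in> hyperboloid_params"
  shows "ln (hyperboloid_density \<theta> x) = ln (minkowski_norm \<theta>) + minkowski_norm \<theta>
    - \<theta> \<bullet> vector [sqrt (1 + (x $ 1)\<^sup>2 + (x $ 2)\<^sup>2), - x $ 1, - x $ 2]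
    - ln (2 * pi * sqrt (1 + (x $ 1)\<^sup>2 + (x $ 2)\<^sup>2))"
proof -
  have "0 < 1 + (x $ 1)\<^sup>2 + (x $ 2)\<^sup>2"
    by (simp add: add_pos_nonneg)
  then show ?thesis
    using minkowski_norm_pos(3)[OF assms]
    by (simp add: hyperboloid_density_def ln_mult ln_div inner_vec_def sum_3)
qed

text \<open>Chain rule: the derivative \<open>1 / r + 1\<close> of \<open>ln r + r\<close>, times
  that of the norm \<open>r\<close>; the inner product contributes its coefficient.\<close>

lemma partial_deriv_ln_hyperboloid_density:
  assumes "\<theta> \<in> hyperboloid_params"
  shows "partial_deriv j (\<lambda>\<eta>. ln (hyperboloid_density \<eta> x)) \<theta> =
    minkowski_sign j * \<theta> $ j * (1 / (minkowski_norm \<theta>)\<^sup>2 + 1 / minkowski_norm \<theta>)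
    - vector [sqrt (1 + (x $ 1)\<^sup>2 + (x $ 2)\<^sup>2), - x $ 1, - x $ 2] $ j"
proof -
  define a :: "real^3" where "a = vector [sqrt (1 + (x $ 1)\<^sup>2 + (x $ 2)\<^sup>2), - x $ 1, - x $ 2]"
  define C where "C = ln (2 * pi * sqrt (1 + (x $ 1)\<^sup>2 + (x $ 2)\<^sup>2))"
  have r: "0 < minkowski_norm \<theta>"
    using minkowski_norm_pos(3)[OF assms] .
  have "partial_deriv j (\<lambda>\<eta>. ln (hyperboloid_density \<eta> x)) \<theta> =
      deriv (\<lambda>t. ln (minkowski_norm (\<theta> + t *\<^sub>R axis j 1)) + minkowski_norm (\<theta> + t *\<^sub>R axis j 1)
        - (\<theta> + t *\<^sub>R axis j 1) \<bullet> a - C) 0"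
    unfolding partial_deriv_def
    by (intro deriv_cong_ev eventually_mono[OF eventually_hyperboloid_params[OF assms, of j]])
      (simp_all add: ln_hyperboloid_density a_def C_def)
  also have "\<dots> = minkowski_sign j * \<theta> $ j * (1 / (minkowski_norm \<theta>)\<^sup>2 + 1 / minkowski_norm \<theta>) - a $ j"
    using r
    by (intro DERIV_imp_deriv)
      (auto intro!: derivative_eq_intros has_derivative_minkowski_norm[OF assms]
        simp: inner_add_left inner_axis' field_simps power2_eq_square)
  finally show ?thesis
    by (simp add: a_def)
qed

text \<open>The only term of the gradient containing \<open>x\<close> is constant in
  \<open>\<theta>\<close>, so a second differentiation removes it and the result is free of
  \<open>x\<close>.\<close>

lemma hessian_ln_hyperboloid_density:
  assumes "\<theta> \<in> hyperboloid_params"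
  defines "r \<equiv> minkowski_norm \<theta>"
  shows "hessian (\<lambda>\<eta>. ln (hyperboloid_density \<eta> x)) \<theta> $ i $ j =
    (if i = j then minkowski_sign i * (1 + r) / r\<^sup>2 else 0)
    - minkowski_sign i * minkowski_sign j * (2 + r) * \<theta> $ i * \<theta> $ j / r^4"
proof -
  define a where "a = vector [sqrt (1 + (x $ 1)\<^sup>2 + (x $ 2)\<^sup>2), - x $ 1, - x $ 2] $ j"
  have r: "0 < minkowski_norm \<theta>"
    using minkowski_norm_pos(3)[OF assms(1)] .
  have "hessian (\<lambda>\<eta>. ln (hyperboloid_density \<eta> x)) \<theta> $ i $ j =
      deriv (\<lambda>t. minkowski_sign j * (\<theta> + t *\<^sub>R axis i 1) $ j
        * (1 / (minkowski_norm (\<theta> + t *\<^sub>R axis i 1))\<^sup>2 + 1 / minkowski_norm (\<theta> + t *\<^sub>R axis i 1)) - a) 0"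
    unfolding hessian_def
    by (simp, subst partial_deriv_def,
        intro deriv_cong_ev eventually_mono[OF eventually_hyperboloid_params[OF assms(1), of i]])
      (simp_all add: partial_deriv_ln_hyperboloid_density a_def)
  \<comment> \<open>Product rule: the first summand differentiates \<open>\<theta> $ j\<close>, the
    second the function \<open>1 / r^2 + 1 / r\<close> of the norm.\<close>
  also have "\<dots> = minkowski_sign j * axis i 1 $ j * (1 / r\<^sup>2 + 1 / r)
      + minkowski_sign j * \<theta> $ j * ((- 2 / r^3 - 1 / r\<^sup>2) * (minkowski_sign i * \<theta> $ i / r))"
    using r unfolding r_def
    by (intro DERIV_imp_deriv)
      (auto intro!: derivative_eq_intros has_derivative_minkowski_norm[OF assms(1)]
        simp: field_simps power2_eq_square power3_eq_cube)
  also have "\<dots> = (if i = j then minkowski_sign i * (1 + r) / r\<^sup>2 else 0)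
      - minkowski_sign i * minkowski_sign j * (2 + r) * \<theta> $ i * \<theta> $ j / r^4"
    using r by (auto simp: r_def axis_def field_simps power2_eq_square power3_eq_cube power4_eq_xxxx)
  finally show ?thesis .
qed

section \<open>The Fisher information matrix\<close>

theorem mainTheorem14:
  fixes \<theta> :: "real^3" and \<theta>\<^sub>0 \<theta>\<^sub>1 \<theta>\<^sub>2 r :: real
  assumes "\<theta> = vector [\<theta>\<^sub>0, \<theta>\<^sub>1, \<theta>\<^sub>2]"
    and "\<theta> \<in> hyperboloid_params"
    and "r = minkowski_norm \<theta>"
  shows "fisher_information hyperboloid_density \<theta> =
    (1 / r^4) *\<^sub>R vector [
      vector [(2 + r) * \<theta>\<^sub>0^2 - r^2 * (1 + r), - (2 + r) * \<theta>\<^sub>0 * \<theta>\<^sub>1, - (2 + r) * \<theta>\<^sub>0 * \<theta>\<^sub>2],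
      vector [- (2 + r) * \<theta>\<^sub>0 * \<theta>\<^sub>1, (2 + r) * \<theta>\<^sub>1^2 + r^2 * (1 + r), (2 + r) * \<theta>\<^sub>1 * \<theta>\<^sub>2],
      vector [- (2 + r) * \<theta>\<^sub>0 * \<theta>\<^sub>2, (2 + r) * \<theta>\<^sub>1 * \<theta>\<^sub>2, (2 + r) * \<theta>\<^sub>2^2 + r^2 * (1 + r)]]"
proof -
  define M where "M = density lborel (\<lambda>x. ennreal (hyperboloid_density \<theta> x))"
  \<comment> \<open>The point 0 is an arbitrary representative, as the Hessian is the same at every
    \<open>x\<close>.\<close>
  define H where "H = hessian (\<lambda>\<eta>. ln (hyperboloid_density \<eta> 0)) \<theta>"
  have r: "0 < r"
    using minkowski_norm_pos(3) assms by simp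
  \<comment> \<open>Finite mass makes the constant \<open>H\<close> integrable, so the default value
    0 of the Bochner integral does not arise; mass 1 makes the expectation \<open>H\<close>
    itself.\<close>
  have "emeasure M (space M) = 1"
    using nn_integral_hyperboloid_density[OF assms(2)] by (simp add: M_def emeasure_density)
  then have mass: "measure M (space M) = 1"
    by (simp add: measure_def)
  have "hessian (\<lambda>\<eta>. ln (hyperboloid_density \<eta> x)) \<theta> = H" for x
    by (simp add: H_def vec_eq_iff hessian_ln_hyperboloid_density[OF assms(2)])
  then have fisher: "fisher_information hyperboloid_density \<theta> = - H"
    unfolding fisher_information_def M_def[symmetric] by (simp add: mass)
  have H: "H $ i $ j = (if i = j then minkowski_sign i * (1 + r) / r\<^sup>2 else 0)
      - minkowski_sign i * minkowski_sign j * (2 + r) * \<theta> $ i * \<theta> $ j / r^4" for i j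
    unfolding H_def assms(3) by (rule hessian_ln_hyperboloid_density[OF assms(2)])
  have \<theta>: "\<theta> $ 1 = \<theta>\<^sub>0" "\<theta> $ 2 = \<theta>\<^sub>1" "\<theta> $ 3 = \<theta>\<^sub>2"
    using assms(1) by simp_all
  show ?thesis
    unfolding fisher vec_eq_iff forall_3 using r
    by (simp add: H \<theta> minkowski_sign_def) (simp add: field_simps power2_eq_square power4_eq_xxxx)
qed

end
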